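(* Let $f\colon \mathbb{R}\to[0,1]$ be a nice function whose Fourier transform $\widehat f$ is real-valued and non-negative, with $\widehat f(0)>0$. Let $q,n$ be positive integers. For any real $s>0$ and any $\mathbf{y}=(y_1,\dots,y_n)\in\mathbb{R}_q^n$, defining the weight vector $W=W_{s,\mathbf{y}}$ (assumed nonzero, so that its correlation is defined), and any $\mathbf{c}=(c_1,\dots,c_n)\in\mathbb{Z}_q^n$, $$\operatorname{corr}(W,\mathbf{c})\;\ge\;\frac{\frac1n\sum_{i=1}^n f_s(y_i-c_i)}{\sqrt{f_s(\mathcal{L}_q)}}\;\ge\;\frac{f_s(\mathbf{y}-\mathbf{c})^{1/n}}{\sqrt{f_s(\mathcal{L}_q)}}.$$
   Context: Notation: $\mathbb{Z}_q=\mathbb{Z}/q\mathbb{Z}$ and $\mathbb{R}_q=\mathbb{R}/q\mathbb{Z}$ (additive group); an element of $\mathbb{R}_q$ is a coset of $q\mathbb{Z}$ in $\mathbb{R}$, and an element of $\mathbb{R}_q^n$ is regarded as a coset of $q\mathbb{Z}^n$ in $\mathbb{R}^n$. For a function $f$ on $\mathbb{R}$, its multiplicative extension to $\mathbb{R}^k$ is $f^k(\mathbf{x})=\prod_{i=1}^k f(x_i)$, also written $f$; for $s>0$, $f_s(\mathbf{x})=f(\mathbf{x}/s)$. For a countable set $X$, $f(X)=\sum_{\mathbf{x}\in X}f(\mathbf{x})$. In particular, for $y_i\in\mathbb{R}_q$ and $c_i\in\mathbb{Z}_q$, $f_s(y_i-c_i)$ is the sum of $f_s$ over all elements of the coset $y_i-c_i$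 of $q\mathbb{Z}$, and $f_s(\mathbf{y}-\mathbf{c})$ is the sum of $f_s$ over the coset $\mathbf{y}-\mathbf{c}$ of $q\mathbb{Z}^n$. Fourier transform: $\widehat f(\mathbf{w})=\int_{\mathbb{R}^k} f(\mathbf{x})e^{-2\pi i\langle \mathbf{x},\mathbf{w}\rangle}\,d\mathbf{x}$. Nice: $f$ is Borel measurable and absolutely integrable, and satisfies conditions sufficient for the Poisson summation formula; that is, for every $k\ge1$, full-rank lattice $\mathcal{L}\subset\mathbb{R}^k$, $s>0$ and $\mathbf{y}\in\mathbb{R}^k$, $f_s(\mathbf{y}+\mathcal{L})=\det(\mathcal{L}^* )\sum_{\mathbf{w}\in\mathcal{L}^*}\widehat{f_s}(\mathbf{w})e^{2\pi i\langle\mathbf{w},\mathbf{y}\rangle}$ with both series absolutely convergent, where $\mathcal{L}^*$ is the dual lattice. Weight vector: for $y\in\mathbb{R}_q$, $W_{s,y}\colon\mathbb{Z}_q\to\mathbb{R}_{\ge0}$ is $W_{s,y}(x)=f_s(y-x)$ (sum over the coset $y-x$ of $q\mathbb{Z}$), regarded as a vector in $\mathbb{R}_{\ge0}^q$; and $W_{s,\mathbf{y}}=(W_{s,y_1},\dots,W_{s,y_n})\in\mathbb{R}_{\ge0}^{qn}$. Correlation: for $\mathbf{c}\in\mathbb{Z}_q^n$, $[\mathbf{c}]=([c_1],\dots,[c_n])\in\{0,1\}^{qn}$ where $[c]\in\{0,1\}^q$ is the indicator vector of $c\in\mathbb{Z}_q$; and $\operatorname{corr}(W,\mathbf{c})=\dfrac{\langle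 W,[\mathbf{c}]\rangle}{\|W\|_2\sqrt n}$. Lattice: $\mathcal{L}_q=\bigcup_{z\in\mathbb{Z}}\big((z,z)+q\mathbb{Z}^2\big)\subset\mathbb{Z}^2$. *)

theory Defs
  imports "HOL-Analysis.Analysis" "Jordan_Normal_Form.Determinant"
begin

text \<open>
  Dimensions vary inside the definition of niceness, so \<open>\<real>\<^sup>k\<close> is the set of extensional
  functions \<open>{..<k} \<rightarrow>\<^sub>E UNIV\<close>, which is the space of the product measure
  \<open>Pi\<^sub>M {..<k} (\<lambda>_. lborel)\<close>, that is, of Lebesgue measure on \<open>\<real>\<^sup>k\<close>.
\<close>

definition Rspace :: "nat \<Rightarrow> (nat \<Rightarrow> real) set" where
  "Rspace k = {..<k} \<rightarrow>\<^sub>E UNIV"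

definition ip :: "nat \<Rightarrow> (nat \<Rightarrow> real) \<Rightarrow> (nat \<Rightarrow> real) \<Rightarrow> real" where
  "ip k x w = (\<Sum>i<k. x i * w i)"

definition mult_ext :: "(real \<Rightarrow> real) \<Rightarrow> nat \<Rightarrow> (nat \<Rightarrow> real) \<Rightarrow> real" where
  "mult_ext f k x = (\<Prod>i<k. f (x i))"

definition scaled :: "(real \<Rightarrow> real) \<Rightarrow> real \<Rightarrow> real \<Rightarrow> real" where
  "scaled f s x = f (x / s)"


definition fourier :: "(real \<Rightarrow> real) \<Rightarrow> real \<Rightarrow> complex" where
  "fourier f w = (\<integral>x. complex_of_real (f x) * exp (- 2 * pi * \<i> * (x * w)) \<partial>lborel)"

definition fourier_vec :: "nat \<Rightarrow> ((nat \<Rightarrow> real) \<Rightarrow> real) \<Rightarrow> (nat \<Rightarrow> real) \<Rightarrow> complex" where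
  "fourier_vec k g w =
     (\<integral>x. complex_of_real (g x) * exp (- 2 * pi * \<i> * ip k x w) \<partial>Pi\<^sub>M {..<k} (\<lambda>_. lborel))"


definition lattice_basis :: "nat \<Rightarrow> (nat \<Rightarrow> nat \<Rightarrow> real) \<Rightarrow> (nat \<Rightarrow> real) set \<Rightarrow> bool" where
  "lattice_basis k b L \<longleftrightarrow>
     (\<forall>i<k. b i \<in> Rspace k) \<and>
     (\<forall>a :: nat \<Rightarrow> real. (\<forall>j<k. (\<Sum>i<k. a i * b i j) = 0) \<longrightarrow> (\<forall>i<k. a i = 0)) \<and>
     L = range (\<lambda>z :: nat \<Rightarrow> int. \<lambda>j\<in>{..<k}. \<Sum>i<k. of_int (z i) * b i j)"

definition full_rank_lattice :: "nat \<Rightarrow> (nat \<Rightarrow> real) set \<Rightarrow> bool" where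
  "full_rank_lattice k L \<longleftrightarrow> (\<exists>b. lattice_basis k b L)"

text \<open>The absolute value of the determinant does not depend on the chosen basis.\<close>

definition lattice_det :: "nat \<Rightarrow> (nat \<Rightarrow> real) set \<Rightarrow> real" where
  "lattice_det k L =
     (let b = (SOME b. lattice_basis k b L) in \<bar>Determinant.det (mat k k (\<lambda>(i, j). b i j))\<bar>)"

definition dual_lattice :: "nat \<Rightarrow> (nat \<Rightarrow> real) set \<Rightarrow> (nat \<Rightarrow> real) set" where
  "dual_lattice k L = {w \<in> Rspace k. \<forall>x\<in>L. ip k w x \<in> \<int>}"

definition translate :: "nat \<Rightarrow> (nat \<Rightarrow> real) \<Rightarrow> (nat \<Rightarrow> real) set \<Rightarrow> (nat \<Rightarrow> real) set" where
  "translate k y L = (\<lambda>x. \<lambda>i\<in>{..<k}. y i + x i) ` L"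


definition poisson_summation :: "(real \<Rightarrow> real) \<Rightarrow> bool" where
  "poisson_summation f \<longleftrightarrow>
     (\<forall>k L s y. k \<ge> 1 \<and> full_rank_lattice k L \<and> s > 0 \<and> y \<in> Rspace k \<longrightarrow>
        (let g = mult_ext (scaled f s) k;
             h = (\<lambda>w. fourier_vec k g w * exp (2 * pi * \<i> * ip k w y)) in
         (\<lambda>x. norm (g x)) summable_on translate k y L \<and>
         (\<lambda>w. norm (h w)) summable_on dual_lattice k L \<and>
         complex_of_real (\<Sum>\<^sub>\<infinity>x\<in>translate k y L. g x) =
           lattice_det k (dual_lattice k L) * (\<Sum>\<^sub>\<infinity>w\<in>dual_lattice k L. h w)))"

definition nice :: "(real \<Rightarrow> real) \<Rightarrow> bool" where
  "nice f \<longleftrightarrow> f \<in> borel_measurable borel \<and> integrable lborel f \<and> poisson_summation f"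


text \<open>
  The elements of \<open>\<int>/q\<int>\<close> and \<open>\<real>/q\<int>\<close> are the actual cosets \<open>t + q\<int>\<close>, as sets of integers and
  of reals respectively.
\<close>

definition qcoset :: "'a::ring_1 \<Rightarrow> 'a \<Rightarrow> 'a set" where
  "qcoset q t = range (\<lambda>m::int. t + q * of_int m)"

definition Zmod :: "nat \<Rightarrow> int set set" where
  "Zmod q = range (qcoset (int q))"

definition Rmod :: "nat \<Rightarrow> real set set" where
  "Rmod q = range (qcoset (real q))"

definition coset_diff :: "real set \<Rightarrow> int set \<Rightarrow> real set" where
  "coset_diff y c = {a - of_int b | a b. a \<in> y \<and> b \<in> c}"

text \<open>
  A tuple of cosets of \<open>q\<int>\<close> is identified with their product, which is a coset of \<open>q\<int>\<^sup>n\<close> in \<open>\<real>\<^sup>n\<close>.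
\<close>

definition coset_diff_vec ::
    "nat \<Rightarrow> (nat \<Rightarrow> real set) \<Rightarrow> (nat \<Rightarrow> int set) \<Rightarrow> (nat \<Rightarrow> real) set" where
  "coset_diff_vec n y c = (\<Pi>\<^sub>E i\<in>{..<n}. coset_diff (y i) (c i))"


text \<open>Vectors in \<open>\<real>\<^sup>q\<^sup>n\<close> are functions on the index set \<open>{..<n} \<times> \<int>/q\<int>\<close>.\<close>

definition weight :: "(real \<Rightarrow> real) \<Rightarrow> real \<Rightarrow> real set \<Rightarrow> int set \<Rightarrow> real" where
  "weight f s y x = (\<Sum>\<^sub>\<infinity>t\<in>coset_diff y x. scaled f s t)"

definition weight_vec ::
    "(real \<Rightarrow> real) \<Rightarrow> real \<Rightarrow> (nat \<Rightarrow> real set) \<Rightarrow> nat \<times> int set \<Rightarrow> real" where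
  "weight_vec f s y = (\<lambda>(i, x). weight f s (y i) x)"

definition indicator_vec :: "(nat \<Rightarrow> int set) \<Rightarrow> nat \<times> int set \<Rightarrow> real" where
  "indicator_vec c = (\<lambda>(i, x). indicator {c i} x)"

definition corr :: "nat \<Rightarrow> nat \<Rightarrow> (nat \<times> int set \<Rightarrow> real) \<Rightarrow> (nat \<Rightarrow> int set) \<Rightarrow> real" where
  "corr q n W c =
     (\<Sum>p\<in>{..<n} \<times> Zmod q. W p * indicator_vec c p) /
     (L2_set W ({..<n} \<times> Zmod q) * sqrt (real n))"


definition Lq :: "nat \<Rightarrow> (nat \<Rightarrow> real) set" where
  "Lq q = (\<Union>z::int. {x \<in> Rspace 2. x 0 \<in> qcoset (real q) (of_int z) \<and>
                                  x 1 \<in> qcoset (real q) (of_int z)})"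

end

theory Submission
  imports Defs
begin

text \<open>
  For \<open>y = t + q\<int>\<close>, the sum of \<open>f\<^sub>s(y - x)\<^sup>2\<close> over \<open>x \<in> \<int>/q\<int>\<close> is the sum of \<open>f\<^sub>s\<close> over the
  translate of \<open>\<L>\<^sub>q\<close> by \<open>(t, t)\<close>. Since the Fourier transform of \<open>f\<close> is non-negative, Poisson
  summation shows that this is largest for \<open>t = 0\<close>, so \<open>\<parallel>W\<parallel>\<^sup>2 \<le> n f\<^sub>s(\<L>\<^sub>q)\<close>, which is the first
  inequality. The second one is the AM-GM inequality for the numbers \<open>f\<^sub>s(y\<^sub>i - c\<^sub>i)\<close>, whose product
  is the sum of \<open>f\<^sub>s\<close> over a product of cosets.
\<close>

section \<open>Fourier transforms of multiplicative extensions and dilations\<close>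

lemma fourier_vec_mult_ext:
  assumes "integrable lborel g"
  shows "fourier_vec k (mult_ext g k) w = (\<Prod>i<k. fourier g (w i))"
proof -
  interpret product_sigma_finite "\<lambda>_::nat. lborel :: real measure"
    by standard
  let ?h = "\<lambda>i x. complex_of_real (g x) * exp (- 2 * pi * \<i> * (complex_of_real x * complex_of_real (w i)))"
  have int: "integrable lborel (?h i)" for i
  proof (rule Bochner_Integration.integrable_bound[OF assms])
    show "?h i \<in> borel_measurable lborel"
      using assms by measurable
    show "AE x in lborel. norm (?h i x) \<le> norm (g x)"
      by (simp add: norm_mult)
  qed
  \<comment> \<open>The phase of an inner product is the product of the coordinate phases, so the
    integrand separates and its integral over the product measure factors.\<close>
  have "complex_of_real (mult_ext g k x) * exp (- 2 * pi * \<i> * ip k x w) = (\<Prod>i<k. ?h i (x i))"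
    for x
    by (simp add: mult_ext_def ip_def prod.distrib exp_sum[symmetric] sum_distrib_left sum_negf)
  then show ?thesis
    unfolding fourier_vec_def fourier_def
    by (simp only: product_integral_prod[OF finite_lessThan int])
qed

lemma integrable_scaled:
  assumes "integrable lborel f" "s > 0"
  shows "integrable lborel (scaled f s)"
  using lborel_integrable_real_affine[OF assms(1), of "1 / s" 0] assms(2)
  by (simp add: scaled_def[abs_def])

text \<open>The substitution x = s u has Jacobian s and moves the dilation onto the
  frequency.\<close>

lemma fourier_scaled:
  assumes "s > 0"
  shows "fourier (scaled f s) w = s * fourier f (s * w)"
  unfolding fourier_def using assms
  by (subst lborel_integral_real_affine[of s _ 0])
    (simp_all add: scaled_def scaleR_conv_of_real mult_ac)

text \<open>Being real and non-negative passes from \<open>f\<close> to its dilation through the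
  factor s > 0, and then to finite products. Equality with the norm expresses both properties at
  once and can be used for rewriting inside a complex infinite sum.\<close>

lemma fourier_vec_scaled_nonneg:
  assumes "integrable lborel f" "s > 0"
    and "\<And>w. fourier f w \<in> \<real> \<and> 0 \<le> Re (fourier f w)"
  shows "fourier_vec k (mult_ext (scaled f s) k) w
       = complex_of_real (norm (fourier_vec k (mult_ext (scaled f s) k) w))"
proof -
  have "fourier f v = complex_of_real (norm (fourier f v))" for v
    using assms(3)[of v] by (simp add: complex_is_Real_iff complex_eq_iff cmod_eq_Re)
  then have "fourier (scaled f s) v = complex_of_real (norm (fourier (scaled f s) v))" for v
    using \<open>s > 0\<close> by (simp add: fourier_scaled norm_mult)
  then have "(\<Prod>i<k. fourier (scaled f s) (w i))
      = (\<Prod>i<k. complex_of_real (norm (fourier (scaled f s) (w i))))"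
    by (intro prod.cong) auto
  then show ?thesis
    by (simp add: fourier_vec_mult_ext integrable_scaled assms prod_norm[symmetric])
qed

section \<open>Sums over translates of a lattice\<close>

lemma full_rank_lattice_subset: "full_rank_lattice k L \<Longrightarrow> L \<subseteq> Rspace k"
  unfolding full_rank_lattice_def lattice_basis_def Rspace_def
  by (auto simp del: restrict_apply intro!: restrict_PiE_iff[THEN iffD2])

lemma translate_zero:
  assumes "L \<subseteq> Rspace k"
  shows "translate k (\<lambda>i\<in>{..<k}. 0) L = L"
proof -
  have "(\<lambda>i\<in>{..<k}. (\<lambda>i\<in>{..<k}. 0) i + x i) = x" if "x \<in> L" for x
    using assms that by (auto simp: Rspace_def PiE_def extensional_def fun_eq_iff)
  then show ?thesis
    by (simp add: translate_def cong: image_cong_simp)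
qed

text \<open>Passing from \<open>y\<close> to \<open>0\<close> replaces the phases in the Poisson summation formula by \<open>1\<close>,
  which can only increase a sum of non-negative terms.\<close>

lemma infsum_translate_le:
  assumes "nice f" "\<And>w. fourier f w \<in> \<real> \<and> 0 \<le> Re (fourier f w)"
    and "k \<ge> 1" "full_rank_lattice k L" "s > 0" "y \<in> Rspace k"
  shows "(\<Sum>\<^sub>\<infinity>x\<in>translate k y L. mult_ext (scaled f s) k x)
       \<le> (\<Sum>\<^sub>\<infinity>x\<in>L. mult_ext (scaled f s) k x)"
proof -
  let ?g = "mult_ext (scaled f s) k"
  let ?F = "fourier_vec k ?g"
  let ?h = "\<lambda>y w. ?F w * exp (2 * pi * \<i> * ip k w y)"
  let ?D = "lattice_det k (dual_lattice k L)"
  let ?z = "\<lambda>i\<in>{..<k}. 0::real"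
  have int: "integrable lborel f"
    using \<open>nice f\<close> by (simp add: nice_def)
  note F = fourier_vec_scaled_nonneg[OF int \<open>s > 0\<close> assms(2)]
  have poisson: "(\<lambda>w. norm (?h y w)) summable_on dual_lattice k L"
    "complex_of_real (\<Sum>\<^sub>\<infinity>x\<in>translate k y L. ?g x) = ?D * (\<Sum>\<^sub>\<infinity>w\<in>dual_lattice k L. ?h y w)"
    if "y \<in> Rspace k" for y
    using assms(1,3-5) that unfolding nice_def poisson_summation_def Let_def by blast+
  have z: "?z \<in> Rspace k"
    by (simp add: Rspace_def)
  \<comment> \<open>The determinant is an absolute value, hence non-negative whichever basis
    \<open>SOME\<close> selects.\<close>
  have D: "?D \<ge> 0"
    by (simp add: lattice_det_def Let_def)
  have norm_h: "norm (?h y w) = norm (?F w)" for y w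
    by (simp add: norm_mult)
  \<comment> \<open>At the origin every phase is 1 and the translate is \<open>L\<close> itself, so
    Poisson summation expresses the sum over \<open>L\<close> by the transforms alone.\<close>
  have "ip k w ?z = 0" for w
    by (simp add: ip_def)
  then have "complex_of_real (infsum ?g L) = ?D * (\<Sum>\<^sub>\<infinity>w\<in>dual_lattice k L. ?F w)"
    using poisson(2)[OF z] by (simp add: translate_zero full_rank_lattice_subset assms)
  also have "(\<Sum>\<^sub>\<infinity>w\<in>dual_lattice k L. ?F w)
      = complex_of_real (\<Sum>\<^sub>\<infinity>w\<in>dual_lattice k L. norm (?F w))"
  proof -
    have "(\<lambda>w. norm (?F w)) summable_on dual_lattice k L"
      using poisson(1)[OF z] by (simp only: norm_h)
    then show ?thesis
      by (subst F) (intro infsumI has_sum_of_real has_sum_infsum)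
  qed
  finally have L: "infsum ?g L = ?D * (\<Sum>\<^sub>\<infinity>w\<in>dual_lattice k L. norm (?F w))"
    by (metis of_real_eq_iff of_real_mult)
  have "infsum ?g (translate k y L) \<le> norm (complex_of_real (infsum ?g (translate k y L)))"
    by simp
  also have "\<dots> = ?D * norm (\<Sum>\<^sub>\<infinity>w\<in>dual_lattice k L. ?h y w)"
    using D by (simp only: poisson(2)[OF assms(6)] norm_mult norm_of_real abs_of_nonneg)
  also have "\<dots> \<le> ?D * (\<Sum>\<^sub>\<infinity>w\<in>dual_lattice k L. norm (?h y w))"
    using D poisson(1)[OF assms(6)] by (intro mult_left_mono norm_infsum_bound)
  finally show ?thesis
    by (simp only: norm_h L)
qed

section \<open>The lattice \<open>Lq q\<close> and its basis\<close>

lemma Lq_iff: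
  "x \<in> Lq q \<longleftrightarrow> x \<in> Rspace 2 \<and> (\<exists>z k. x 0 = of_int z \<and> x 1 = of_int z + real q * of_int k)"
proof (intro iffI conjI)
  assume "x \<in> Lq q"
  then obtain z k l where x: "x \<in> Rspace 2" "x 0 = of_int z + real q * of_int k"
    "x 1 = of_int z + real q * of_int l"
    by (auto simp: Lq_def qcoset_def)
  then show "x \<in> Rspace 2" by blast
  \<comment> \<open>The multiple of q in the first coordinate is absorbed into the diagonal part.
    The two integers that remain are the coordinates in the basis (1,1), (0,q) used below.\<close>
  from x have "x 0 = of_int (z + int q * k)"
    "x 1 = of_int (z + int q * k) + real q * of_int (l - k)"
    by (simp_all add: algebra_simps)
  then show "\<exists>z k. x 0 = of_int z \<and> x 1 = of_int z + real q * of_int k" by blast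
next
  assume "x \<in> Rspace 2 \<and> (\<exists>z k. x 0 = of_int z \<and> x 1 = of_int z + real q * of_int k)"
  then obtain z k where "x \<in> Rspace 2" "x 0 = of_int z + real q * of_int 0"
    "x 1 = of_int z + real q * of_int k"
    by auto
  then show "x \<in> Lq q"
    unfolding Lq_def qcoset_def by blast
qed

lemma full_rank_lattice_Lq:
  assumes "q > 0"
  shows "full_rank_lattice 2 (Lq q)"
proof -
  \<comment> \<open>The rows are \<open>b 0\<close> = (1,1) and \<open>b 1\<close> = (0,q). They are
    independent because q > 0.\<close>
  define b :: "nat \<Rightarrow> nat \<Rightarrow> real" where
    "b i = (\<lambda>j\<in>{..<2}. if i = 0 then 1 else if j = 0 then 0 else real q)" for i
  have two: "{..<2::nat} = {0, 1}"
    by auto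
  have sum_b: "(\<Sum>i<2. a i * b i 0) = a 0" "(\<Sum>i<2. a i * b i 1) = a 0 + a 1 * real q" for a
    by (simp_all add: b_def two)
  have "Lq q = range (\<lambda>z :: nat \<Rightarrow> int. \<lambda>j\<in>{..<2}. \<Sum>i<2. of_int (z i) * b i j)"
  proof (intro Set.set_eqI iffI)
    fix x assume "x \<in> Lq q"
    then obtain z k where x: "x \<in> Rspace 2" "x 0 = of_int z" "x 1 = of_int z + real q * of_int k"
      by (auto simp: Lq_iff)
    define w where "w i = (if i = 0 then z else k)" for i :: nat
    have w: "(\<Sum>i<2. of_int (w i) * b i 0) = of_int z"
      "(\<Sum>i<2. of_int (w i) * b i 1) = of_int z + real q * of_int k"
      by (simp_all add: sum_b(1) sum_b(2)[unfolded One_nat_def] w_def)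
    have "x j = (\<lambda>j\<in>{..<2}. \<Sum>i<2. of_int (w i) * b i j) j" for j
    proof -
      consider "j = 0" | "j = 1" | "j \<notin> {..<2}"
        by fastforce
      then show ?thesis
        using x w by cases (auto simp: Rspace_def PiE_def extensional_def)
    qed
    then show "x \<in> range (\<lambda>z :: nat \<Rightarrow> int. \<lambda>j\<in>{..<2}. \<Sum>i<2. of_int (z i) * b i j)"
      by blast
  next
    fix x assume "x \<in> range (\<lambda>z :: nat \<Rightarrow> int. \<lambda>j\<in>{..<2}. \<Sum>i<2. of_int (z i) * b i j)"
    then obtain z :: "nat \<Rightarrow> int" where x: "x = (\<lambda>j\<in>{..<2}. \<Sum>i<2. of_int (z i) * b i j)"
      by blast
    then have "x 0 = of_int (z 0)" "x 1 = of_int (z 0) + real q * of_int (z 1)"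
      by (simp_all add: sum_b(1) sum_b(2)[unfolded One_nat_def])
    then show "x \<in> Lq q"
      unfolding Lq_iff by (auto simp: x Rspace_def)
  qed
  moreover have "a i = 0" if "\<forall>j<2. (\<Sum>i<2. a i * b i j) = 0" "i < 2" for a :: "nat \<Rightarrow> real" and i
  proof -
    have "(\<Sum>i<2. a i * b i 0) = 0" "(\<Sum>i<2. a i * b i 1) = 0"
      using that(1) by auto
    then have "a 0 = 0" "a 1 = 0"
      unfolding sum_b using \<open>q > 0\<close> by auto
    then show ?thesis
      using \<open>i < 2\<close> by (auto simp: less_2_cases_iff)
  qed
  moreover have "b i \<in> Rspace 2" for i
    by (simp add: b_def Rspace_def)
  ultimately show ?thesis
    unfolding full_rank_lattice_def lattice_basis_def by blast
qed

section \<open>Residue classes and differences of cosets\<close>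

lemma coset_diff_qcoset:
  "coset_diff (qcoset (real q) t) (qcoset (int q) m) = qcoset (real q) (t - of_int m)"
proof (intro Set.set_eqI iffI)
  fix x assume "x \<in> coset_diff (qcoset (real q) t) (qcoset (int q) m)"
  then obtain k l where "x = (t + real q * of_int k) - of_int (m + int q * l)"
    by (auto simp: coset_diff_def qcoset_def)
  then have "x = (t - of_int m) + real q * of_int (k - l)"
    by (simp add: algebra_simps)
  then show "x \<in> qcoset (real q) (t - of_int m)"
    unfolding qcoset_def by blast
next
  fix x assume "x \<in> qcoset (real q) (t - of_int m)"
  then obtain k where "x = t - of_int m + real q * of_int k"
    by (auto simp: qcoset_def)
  then have "x = (t + real q * of_int k) - of_int (m + int q * of_int 0)"
    by simp
  then show "x \<in> coset_diff (qcoset (real q) t) (qcoset (int q) m)"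
    unfolding coset_diff_def qcoset_def by blast
qed

lemma qcoset_eqI:
  assumes "a = b + int q * k"
  shows "qcoset (int q) a = qcoset (int q) b"
proof -
  have "a + int q * m = b + int q * (k + m)" for m
    using assms by (simp add: algebra_simps)
  then have "qcoset (int q) a = range ((\<lambda>m. b + int q * m) \<circ> (+) k)"
    by (simp add: qcoset_def o_def)
  \<comment> \<open>The shift \<open>(+) k\<close> permutes the integers, so composing with it
    leaves the range unchanged.\<close>
  then show ?thesis
    by (simp only: image_comp[symmetric] surj_plus) (simp add: qcoset_def)
qed

lemma finite_Zmod:
  assumes "q > 0"
  shows "finite (Zmod q)"
proof -
  \<comment> \<open>Each class is represented by the remainder \<open>m mod int q\<close>.\<close>
  have "qcoset (int q) m \<in> qcoset (int q) ` {0..<int q}" for m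
    using qcoset_eqI[of m "m mod int q" q "m div int q"] assms by force
  then have "Zmod q \<subseteq> qcoset (int q) ` {0..<int q}"
    by (auto simp: Zmod_def)
  then show ?thesis
    by (rule finite_subset) simp
qed

text \<open>A common element of y - x and y - x' forces the representatives of x and x' to be
  congruent modulo q. This lets a sum over the union of these cosets be split class by
  class.\<close>

lemma coset_diff_disjoint:
  assumes "y \<in> Rmod q" "x \<in> Zmod q" "x' \<in> Zmod q" "x \<noteq> x'"
  shows "coset_diff y x \<inter> coset_diff y x' = {}"
proof (rule ccontr)
  assume ne: "coset_diff y x \<inter> coset_diff y x' \<noteq> {}"
  obtain t m m' where eq: "y = qcoset (real q) t" "x = qcoset (int q) m" "x' = qcoset (int q) m'"
    using assms by (auto simp: Rmod_def Zmod_def)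
  from ne obtain k l where "t - of_int m + real q * of_int k = t - of_int m' + real q * of_int l"
    unfolding eq coset_diff_qcoset by (auto simp: qcoset_def)
  then have "real_of_int m = of_int (m' + int q * (k - l))"
    by (simp add: algebra_simps)
  then have "m = m' + int q * (k - l)"
    by (simp only: of_int_eq_iff)
  then show False
    using qcoset_eqI assms(4) eq by blast
qed

text \<open>A point of (z,z) + qZ^2 shifted by (t,t) has both coordinates in the single coset t + z
  + qZ. Grouping points by the class of z cuts the translate into squares of cosets, over which the
  sum of the extension of \<open>f\<close> is a squared weight.\<close>

lemma translate_Lq:
  "translate 2 (\<lambda>i\<in>{..<2}. t) (Lq q)
     = (\<Union>x\<in>Zmod q. {..<2} \<rightarrow>\<^sub>E coset_diff (qcoset (real q) t) x)"
proof (intro Set.set_eqI iffI)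
  fix x assume "x \<in> translate 2 (\<lambda>i\<in>{..<2}. t) (Lq q)"
  then obtain u where u: "u \<in> Lq q" "x = (\<lambda>i\<in>{..<2}. t + u i)"
    by (auto simp: translate_def cong: restrict_cong)
  then obtain z where z: "u 0 \<in> qcoset (real q) (of_int z)" "u 1 \<in> qcoset (real q) (of_int z)"
    by (auto simp: Lq_def)
  \<comment> \<open>\<open>coset_diff\<close> subtracts, so the diagonal point z belongs to the
    class of -z. The converse direction likewise uses the witness \<open>- m\<close>.\<close>
  have "t + u i \<in> qcoset (real q) (t - of_int (- z))" if "i < 2" for i
    using z that by (auto simp: qcoset_def less_2_cases_iff)
  then have "x \<in> {..<2} \<rightarrow>\<^sub>E coset_diff (qcoset (real q) t) (qcoset (int q) (- z))"
    unfolding coset_diff_qcoset u(2) by auto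
  then show "x \<in> (\<Union>x\<in>Zmod q. {..<2} \<rightarrow>\<^sub>E coset_diff (qcoset (real q) t) x)"
    by (auto simp: Zmod_def)
next
  fix x :: "nat \<Rightarrow> real"
  assume "x \<in> (\<Union>x\<in>Zmod q. {..<2} \<rightarrow>\<^sub>E coset_diff (qcoset (real q) t) x)"
  then obtain m where x: "x \<in> {..<2} \<rightarrow>\<^sub>E qcoset (real q) (t - of_int m)"
    by (auto simp: Zmod_def coset_diff_qcoset)
  define u where "u = (\<lambda>i\<in>{..<2::nat}. x i - t)"
  have "x i - t \<in> qcoset (real q) (of_int (- m))" if "i < 2" for i
    using PiE_mem[OF x, of i] that by (auto simp: qcoset_def)
  then have "u \<in> Lq q"
    unfolding Lq_def u_def Rspace_def by (auto intro!: exI[of _ "- m"])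
  moreover have "x = (\<lambda>i\<in>{..<2}. (\<lambda>i\<in>{..<2}. t) i + u i)"
    using x by (auto simp: u_def fun_eq_iff PiE_def extensional_def)
  ultimately show "x \<in> translate 2 (\<lambda>i\<in>{..<2}. t) (Lq q)"
    by (auto simp: translate_def)
qed

section \<open>Summability and factorization over products of cosets\<close>

lemma summable_on_factor:
  fixes g :: "real \<Rightarrow> real"
  assumes "mult_ext g 2 summable_on ({..<2} \<rightarrow>\<^sub>E A)"
  shows "g summable_on A"
proof (cases "\<exists>a\<in>A. g a \<noteq> 0")
  case True
  then obtain a where a: "a \<in> A" "g a \<noteq> 0" by blast
  \<comment> \<open>\<open>p b\<close> is the point (a, b). On this slice of the square the product
    is \<open>g a * g b\<close>, so summability over the square restricts to the slice, and the
    nonzero constant \<open>g a\<close> can be cancelled.\<close>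
  define p where "p b = (\<lambda>i\<in>{..<2::nat}. if i = 0 then a else b)" for b
  have inj: "inj_on p A"
    by (rule inj_on_inverseI[of _ "\<lambda>x. x 1"]) (simp add: p_def)
  have sub: "p ` A \<subseteq> {..<2} \<rightarrow>\<^sub>E A"
    unfolding p_def using a by (auto simp del: restrict_apply intro!: restrict_PiE_iff[THEN iffD2])
  have "mult_ext g 2 (p b) = g a * g b" for b
    by (simp add: mult_ext_def p_def lessThan_Suc numeral_2_eq_2 mult.commute)
  moreover from sub have "mult_ext g 2 summable_on p ` A"
    using assms summable_on_subset_banach by blast
  ultimately have "(\<lambda>b. g a * g b) summable_on A"
    by (simp add: summable_on_reindex[OF inj] o_def)
  then show ?thesis
    using a by (simp add: summable_on_cmult_right')
next
  case False
  then show ?thesis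
    by (simp cong: summable_on_cong)
qed

text \<open>Distributivity over a product set requires absolute summability of each factor, which
  for real functions is the same as summability.\<close>

lemma infsum_mult_ext:
  assumes "\<And>i. i < k \<Longrightarrow> g summable_on A i"
  shows "(\<Sum>\<^sub>\<infinity>x\<in>(\<Pi>\<^sub>E i\<in>{..<k}. A i). mult_ext g k x) = (\<Prod>i<k. infsum g (A i))"
  unfolding mult_ext_def using assms
  by (intro infsum_prod_PiE_abs summable_on_iff_abs_summable_on_real[THEN iffD1]) auto

lemma translate_Lq_summable:
  assumes "nice f" "q > 0" "s > 0"
  shows "mult_ext (scaled f s) 2 summable_on translate 2 (\<lambda>i\<in>{..<2}. t) (Lq q)"
proof -
  have "(\<lambda>i\<in>{..<2::nat}. t) \<in> Rspace 2"
    by (simp add: Rspace_def)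
  moreover have "1 \<le> (2::nat)" by simp
  ultimately have "(\<lambda>x. norm (mult_ext (scaled f s) 2 x))
      summable_on translate 2 (\<lambda>i\<in>{..<2}. t) (Lq q)"
    using assms full_rank_lattice_Lq[OF \<open>q > 0\<close>]
    unfolding nice_def poisson_summation_def Let_def by blast
  then show ?thesis
    by (rule abs_summable_summable)
qed

text \<open>The square of the coset is part of a translate of \<open>Lq q\<close>, where niceness
  gives absolute convergence; one factor inherits summability from the square.\<close>

lemma scaled_summable_coset_diff:
  assumes "nice f" "q > 0" "s > 0" "y \<in> Rmod q" "x \<in> Zmod q"
  shows "scaled f s summable_on coset_diff y x"
proof -
  obtain t where y: "y = qcoset (real q) t"
    using assms(4) by (auto simp: Rmod_def)
  have "{..<2} \<rightarrow>\<^sub>E coset_diff y x \<subseteq> translate 2 (\<lambda>i\<in>{..<2}. t) (Lq q)"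
    unfolding translate_Lq y using assms(5) by blast
  then show ?thesis
    using translate_Lq_summable[OF assms(1-3)] summable_on_subset_banach summable_on_factor by blast
qed

section \<open>The norm of the weight vector\<close>

lemma sum_weight_squared_le:
  assumes "nice f" "\<And>w. fourier f w \<in> \<real> \<and> 0 \<le> Re (fourier f w)"
    and "q > 0" "s > 0" "y \<in> Rmod q"
  shows "(\<Sum>x\<in>Zmod q. (weight f s y x)\<^sup>2) \<le> (\<Sum>\<^sub>\<infinity>x\<in>Lq q. mult_ext (scaled f s) 2 x)"
proof -
  let ?g = "mult_ext (scaled f s) 2"
  let ?P = "\<lambda>x. {..<2::nat} \<rightarrow>\<^sub>E coset_diff y x"
  obtain t where y: "y = qcoset (real q) t"
    using assms(5) by (auto simp: Rmod_def)
  \<comment> \<open>The square of a sum over a coset is a double sum, that is, a sum over the square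
    of that coset.\<close>
  have "(weight f s y x)\<^sup>2 = infsum ?g (?P x)" if "x \<in> Zmod q" for x
    using that assms by (subst infsum_mult_ext) (auto simp: weight_def scaled_summable_coset_diff)
  then have "(\<Sum>x\<in>Zmod q. (weight f s y x)\<^sup>2) = (\<Sum>x\<in>Zmod q. infsum ?g (?P x))"
    by simp
  also have "\<dots> = infsum ?g (\<Union>x\<in>Zmod q. ?P x)"
  proof (rule sum_infsum)
    show "?g summable_on ?P x" if "x \<in> Zmod q" for x
      using translate_Lq_summable[OF assms(1,3,4), of t] that
      unfolding translate_Lq y by (auto elim!: summable_on_subset_banach)
    \<comment> \<open>Coordinate 0 of a common point would lie in two disjoint cosets.\<close>
    show "?P x \<inter> ?P x' = {}" if "x \<in> Zmod q" "x' \<in> Zmod q" "x \<noteq> x'" for x x'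
      using coset_diff_disjoint[OF assms(5) that]
      by (auto simp: PiE_Int PiE_eq_empty_iff intro!: exI[of _ "0::nat"])
  qed (simp add: finite_Zmod assms)
  also have "\<dots> = infsum ?g (translate 2 (\<lambda>i\<in>{..<2}. t) (Lq q))"
    by (simp add: translate_Lq y)
  also have "\<dots> \<le> infsum ?g (Lq q)"
    using assms by (intro infsum_translate_le full_rank_lattice_Lq) (auto simp: Rspace_def)
  finally show ?thesis .
qed

section \<open>The correlation and the two inequalities\<close>

lemma sum_mult_indicator_vec:
  assumes "finite A" "c \<in> {..<n} \<rightarrow> A"
  shows "(\<Sum>p\<in>{..<n} \<times> A. W p * indicator_vec c p) = (\<Sum>i<n. W (i, c i))"
proof -
  have "(\<Sum>p\<in>{..<n} \<times> A. W p * indicator_vec c p)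
      = (\<Sum>i<n. \<Sum>x\<in>A. if x = c i then W (i, x) else 0)"
    unfolding sum.cartesian_product'
    by (intro sum.cong refl) (simp add: indicator_vec_def)
  also have "\<dots> = (\<Sum>i<n. W (i, c i))"
    using assms by (auto intro!: sum.cong)
  finally show ?thesis .
qed

theorem theorem3p5:
  fixes f :: "real \<Rightarrow> real" and q n :: nat and s :: real
    and y :: "nat \<Rightarrow> real set" and c :: "nat \<Rightarrow> int set"
  assumes "\<And>x. f x \<in> {0..1}"
    and "nice f"
    and "\<And>w. fourier f w \<in> \<real> \<and> 0 \<le> Re (fourier f w)"
    and "0 < Re (fourier f 0)"
    and "q > 0" and "n > 0" and "s > 0"
    and "y \<in> {..<n} \<rightarrow> Rmod q"
    and "c \<in> {..<n} \<rightarrow> Zmod q"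
    and "\<exists>p\<in>{..<n} \<times> Zmod q. weight_vec f s y p \<noteq> 0"
  shows "corr q n (weight_vec f s y) c
           \<ge> (1 / real n * (\<Sum>i<n. \<Sum>\<^sub>\<infinity>t\<in>coset_diff (y i) (c i). scaled f s t))
               / sqrt (\<Sum>\<^sub>\<infinity>x\<in>Lq q. mult_ext (scaled f s) 2 x) \<and>
         (1 / real n * (\<Sum>i<n. \<Sum>\<^sub>\<infinity>t\<in>coset_diff (y i) (c i). scaled f s t))
               / sqrt (\<Sum>\<^sub>\<infinity>x\<in>Lq q. mult_ext (scaled f s) 2 x)
           \<ge> (\<Sum>\<^sub>\<infinity>x\<in>coset_diff_vec n y c. mult_ext (scaled f s) n x) powr (1 / real n)
               / sqrt (\<Sum>\<^sub>\<infinity>x\<in>Lq q. mult_ext (scaled f s) 2 x)"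
proof -
  let ?S = "\<lambda>i. weight f s (y i) (c i)"
  let ?L = "\<Sum>\<^sub>\<infinity>x\<in>Lq q. mult_ext (scaled f s) 2 x"
  let ?W = "weight_vec f s y"
  let ?N = "L2_set ?W ({..<n} \<times> Zmod q)"
  let ?A = "1 / real n * (\<Sum>i<n. ?S i)"
  have y: "y i \<in> Rmod q" and c: "c i \<in> Zmod q" if "i < n" for i
    using assms(8,9) that by auto
  have fin: "finite (Zmod q)"
    using \<open>q > 0\<close> by (rule finite_Zmod)
  have "scaled f s t \<ge> 0" for t
    using assms(1) by (simp add: scaled_def)
  then have S: "?S i \<ge> 0" for i
    by (simp add: weight_def infsum_nonneg)
  have "?N\<^sup>2 = (\<Sum>i<n. \<Sum>x\<in>Zmod q. (weight f s (y i) x)\<^sup>2)"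
    unfolding L2_set_def
    by (simp add: sum_nonneg weight_vec_def sum.cartesian_product case_prod_unfold)
  also have "\<dots> \<le> (\<Sum>i<n. ?L)"
    by (intro sum_mono sum_weight_squared_le assms y) simp
  finally have N_le: "?N \<le> sqrt (real n * ?L)"
    by (simp add: real_le_rsqrt)
  have N_pos: "?N > 0"
    using assms(10) fin by (simp add: L2_set_nonneg less_le L2_set_eq_0_iff)
  \<comment> \<open>Positivity comes from the nonzero weight vector: 0 < \<open>?N\<close> and
    \<open>?N\<close> is at most the square root of n times \<open>?L\<close>. Hence the divisions
    below are by nonzero numbers.\<close>
  have L_pos: "?L > 0"
    using order.strict_trans2[OF N_pos N_le] \<open>n > 0\<close> by (simp add: zero_less_mult_iff)
  \<comment> \<open>Writing n as the square of \<open>sqrt n\<close> gives the denominator the shape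
    of the one in \<open>corr\<close>, with \<open>?N\<close> replaced by its upper bound.\<close>
  have "?A / sqrt ?L = (\<Sum>i<n. ?S i) / (sqrt (real n * ?L) * sqrt (real n))"
    using \<open>n > 0\<close> by (simp add: real_sqrt_mult field_simps)
  also have "\<dots> \<le> (\<Sum>i<n. ?S i) / (?N * sqrt (real n))"
    using N_le N_pos L_pos \<open>n > 0\<close> by (intro divide_left_mono mult_right_mono sum_nonneg S) auto
  also have "\<dots> = corr q n ?W c"
    using sum_mult_indicator_vec[OF fin assms(9), of ?W] by (simp add: corr_def weight_vec_def)
  finally have 1: "?A / sqrt ?L \<le> corr q n ?W c" .
  \<comment> \<open>The tuple of cosets is a product set, so its sum is the product of the
    coordinate sums, and AM-GM applies to these non-negative numbers.\<close>
  have "(\<Sum>\<^sub>\<infinity>x\<in>coset_diff_vec n y c. mult_ext (scaled f s) n x) = (\<Prod>i<n. ?S i)"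
    unfolding coset_diff_vec_def weight_def
    by (intro infsum_mult_ext scaled_summable_coset_diff[where q = q] assms y c)
  moreover have "(\<Prod>i<n. ?S i) powr (1 / real n) \<le> ?A"
    using arith_geom_mean[of "{..<n}" ?S] S \<open>n > 0\<close>
    by (simp add: sum_divide_distrib lessThan_empty_iff)
  ultimately have "(\<Sum>\<^sub>\<infinity>x\<in>coset_diff_vec n y c. mult_ext (scaled f s) n x) powr (1 / real n)
      / sqrt ?L \<le> ?A / sqrt ?L"
    using L_pos by (simp only: divide_right_mono real_sqrt_ge_zero less_imp_le)
  with 1 show ?thesis
    unfolding weight_def by blast
qed

end
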